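(* Let $n\ge 1$. For $1\le i\le n-1$ let $\varepsilon_{i,i+1}\in\mathcal{IC}_n$ be the map $$\varepsilon_{i,i+1}=\begin{pmatrix}1&\cdots&i-1&i+1&i+2&\cdots&n\\1&\cdots&i-1&i&i+2&\cdots&n\end{pmatrix}$$ (domain $[n]\setminus\{i\}$, $i+1\mapsto i$, all other points of the domain fixed), and for $1\le i\le n$ let $\varepsilon_i=\mathrm{id}_{[n]\setminus\{i\}}$ be the partial identity on $[n]\setminus\{i\}$. A subsemigroup $M$ of $\mathcal{IC}_n$ is maximal if and only if $M$ belongs to one of the following three types: (i) $M_{\mathrm{id}_{[n]}}:=\mathcal{IC}_n\setminus\{\mathrm{id}_{[n]}\}$; (ii) $M_{\varepsilon_{i,i+1}}:=\mathcal{IC}_n\setminus\{\varepsilon_{i,i+1}\}$, for each $1\le i\le n-1$; (iii) $M_{\varepsilon_i}:=\mathcal{IC}_n\setminus\{\varepsilon_i\}$, for each $1\le i\le n$.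
   Context: Let $[n]=\{1,2,\ldots,n\}$ with its usual order. $\mathcal{IC}_n$ is the monoid of all injective partial transformations $\alpha$ of $[n]$ (the empty map allowed) that are isotone ($x\le y$ implies $x\alpha\le y\alpha$ for all $x,y\in\mathrm{Dom}\,\alpha$) and order-decreasing ($x\alpha\le x$ for all $x\in \mathrm{Dom}\,\alpha$), maps being written on the right and composed left to right: $x(\alpha\beta)=(x\alpha)\beta$. In two-line notation the top row lists the domain and the bottom row the images. A maximal subsemigroup of a semigroup $S$ is a proper non-empty subsemigroup $M$ such that $M\subseteq T\subseteq S$ with $T$ a subsemigroup implies $T=M$ or $T=S$. *)

theory Defs
  imports "HOL-Algebra.Group"
begin

text \<open>
  Partial transformations of \<open>[n]\<close> are maps \<^typ>\<open>nat \<Rightarrow> nat option\<close> that are undefined outside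
  \<open>{1..n}\<close>.
\<close>

definition IC_maps :: "nat \<Rightarrow> (nat \<Rightarrow> nat option) set" where
  "IC_maps n = {\<alpha>. dom \<alpha> \<subseteq> {1..n} \<and> ran \<alpha> \<subseteq> {1..n} \<and> inj_on \<alpha> (dom \<alpha>) \<and>
     mono_on (dom \<alpha>) (\<lambda>x. the (\<alpha> x)) \<and> (\<forall>x\<in>dom \<alpha>. the (\<alpha> x) \<le> x)}"

definition partial_id :: "nat set \<Rightarrow> nat \<Rightarrow> nat option" where
  "partial_id A = Some |` A"

text \<open>
  Maps act on the right, so the product of \<open>\<alpha>\<close> and \<open>\<beta>\<close> applies \<open>\<alpha>\<close> first, whereas
  \<open>\<beta> \<circ>\<^sub>m \<alpha>\<close> is written in the order of left actions.
\<close>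

definition IC :: "nat \<Rightarrow> (nat \<Rightarrow> nat option) monoid" where
  "IC n = \<lparr>carrier = IC_maps n, mult = (\<lambda>\<alpha> \<beta>. \<beta> \<circ>\<^sub>m \<alpha>), one = partial_id {1..n}\<rparr>"

definition eps :: "nat \<Rightarrow> nat \<Rightarrow> nat \<Rightarrow> nat option" where
  "eps n i = partial_id ({1..n} - {i})"

text \<open>Meant for \<open>1 \<le> i \<le> n - 1\<close>; the update then leaves the domain \<open>[n] - {i}\<close> unchanged.\<close>

definition eps_succ :: "nat \<Rightarrow> nat \<Rightarrow> nat \<Rightarrow> nat option" where
  "eps_succ n i = (partial_id ({1..n} - {i}))(i + 1 \<mapsto> i)"

definition subsemigroup :: "('a, 'b) monoid_scheme \<Rightarrow> 'a set \<Rightarrow> bool" where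
  "subsemigroup S T \<longleftrightarrow> T \<subseteq> carrier S \<and> (\<forall>x\<in>T. \<forall>y\<in>T. x \<otimes>\<^bsub>S\<^esub> y \<in> T)"

definition maximal_subsemigroup :: "('a, 'b) monoid_scheme \<Rightarrow> 'a set \<Rightarrow> bool" where
  "maximal_subsemigroup S M \<longleftrightarrow>
     subsemigroup S M \<and> M \<noteq> {} \<and> M \<noteq> carrier S \<and>
     (\<forall>T. subsemigroup S T \<and> M \<subseteq> T \<longrightarrow> T = M \<or> T = carrier S)"

lemma IC_maps_iff:
  "\<alpha> \<in> IC_maps n \<longleftrightarrow>
     (\<forall>x y. \<alpha> x = Some y \<longrightarrow> 1 \<le> y \<and> y \<le> x \<and> x \<le> n) \<and>
     (\<forall>x x' y. \<alpha> x = Some y \<longrightarrow> \<alpha> x' = Some y \<longrightarrow> x = x') \<and>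
     (\<forall>x x' y y'. \<alpha> x = Some y \<longrightarrow> \<alpha> x' = Some y' \<longrightarrow> x \<le> x' \<longrightarrow> y \<le> y')"
  (is "_ \<longleftrightarrow> ?D \<and> ?I \<and> ?M")
proof -
  have "inj_on \<alpha> (dom \<alpha>) \<longleftrightarrow> ?I"
  proof
    assume "inj_on \<alpha> (dom \<alpha>)"
    then show ?I
      unfolding inj_on_def by (metis domI)
  next
    assume ?I
    show "inj_on \<alpha> (dom \<alpha>)"
    proof (rule inj_onI)
      fix x x' assume eq: "\<alpha> x = \<alpha> x'" and "x \<in> dom \<alpha>"
      then obtain y where "\<alpha> x = Some y" by blast
      with eq have "\<alpha> x = Some y" "\<alpha> x' = Some y" by simp_all
      with \<open>?I\<close> show "x = x'" by blast
    qed
  qed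
  moreover have "mono_on (dom \<alpha>) (\<lambda>x. the (\<alpha> x)) \<longleftrightarrow> ?M"
  proof
    assume mono: "mono_on (dom \<alpha>) (\<lambda>x. the (\<alpha> x))"
    show ?M
    proof (intro allI impI)
      fix x x' y y' assume "\<alpha> x = Some y" "\<alpha> x' = Some y'" "x \<le> x'"
      with mono_onD[OF mono, of x x'] show "y \<le> y'" by (simp add: domI)
    qed
  next
    assume ?M
    show "mono_on (dom \<alpha>) (\<lambda>x. the (\<alpha> x))"
    proof (rule mono_onI)
      fix x x' assume "x \<in> dom \<alpha>" "x' \<in> dom \<alpha>" "x \<le> x'"
      then obtain y y' where y: "\<alpha> x = Some y" "\<alpha> x' = Some y'" by blast
      with \<open>?M\<close> \<open>x \<le> x'\<close> have "y \<le> y'" by blast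
      with y show "the (\<alpha> x) \<le> the (\<alpha> x')" by simp
    qed
  qed
  moreover have "dom \<alpha> \<subseteq> {1..n} \<and> ran \<alpha> \<subseteq> {1..n} \<and> (\<forall>x\<in>dom \<alpha>. the (\<alpha> x) \<le> x) \<longleftrightarrow> ?D"
  proof
    assume L: "dom \<alpha> \<subseteq> {1..n} \<and> ran \<alpha> \<subseteq> {1..n} \<and> (\<forall>x\<in>dom \<alpha>. the (\<alpha> x) \<le> x)"
    show ?D
    proof (intro allI impI)
      fix x y assume xy: "\<alpha> x = Some y"
      then have "x \<in> dom \<alpha>" "y \<in> ran \<alpha>" by (rule domI, rule ranI)
      with L have "x \<in> {1..n}" "y \<in> {1..n}" "the (\<alpha> x) \<le> x" by blast+
      with xy show "1 \<le> y \<and> y \<le> x \<and> x \<le> n" by simp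
    qed
  next
    assume D: ?D
    have D': "x \<in> {1..n} \<and> y \<in> {1..n} \<and> y \<le> x" if "\<alpha> x = Some y" for x y
    proof -
      from D that have "1 \<le> y \<and> y \<le> x \<and> x \<le> n" by blast
      then show ?thesis by simp
    qed
    have "dom \<alpha> \<subseteq> {1..n}" using D' by blast
    moreover have "ran \<alpha> \<subseteq> {1..n}" using D' unfolding ran_def by blast
    moreover have "\<forall>x\<in>dom \<alpha>. the (\<alpha> x) \<le> x"
    proof
      fix x assume "x \<in> dom \<alpha>"
      then obtain y where "\<alpha> x = Some y" by blast
      with D' show "the (\<alpha> x) \<le> x" by simp
    qed
    ultimately show "dom \<alpha> \<subseteq> {1..n} \<and> ran \<alpha> \<subseteq> {1..n} \<and> (\<forall>x\<in>dom \<alpha>. the (\<alpha> x) \<le> x)"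
      by blast
  qed
  ultimately show ?thesis
    unfolding IC_maps_def by blast
qed

lemma partial_id_eq_Some_iff: "partial_id A x = Some y \<longleftrightarrow> x \<in> A \<and> y = x"
  by (auto simp: partial_id_def restrict_map_def)

lemma eps_in_IC: "eps n i \<in> carrier (IC n)"
proof -
  have "eps n i \<in> IC_maps n"
    unfolding IC_maps_iff eps_def partial_id_eq_Some_iff by simp
  then show ?thesis by (simp add: IC_def)
qed

lemma eps_succ_in_IC:
  assumes "1 \<le> i" "i \<le> n - 1"
  shows "eps_succ n i \<in> carrier (IC n)" "dom (eps_succ n i) = {1..n} - {i}"
proof -
  have iff: "eps_succ n i x = Some y \<longleftrightarrow>
      1 \<le> x \<and> x \<le> n \<and> x \<noteq> i \<and> y = (if x = i + 1 then i else x)" for x y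
    using assms by (cases "x = i + 1") (auto simp: eps_succ_def partial_id_eq_Some_iff)
  have "eps_succ n i \<in> IC_maps n"
    unfolding IC_maps_iff
  proof (intro conjI allI impI)
    fix x y assume "eps_succ n i x = Some y"
    then show "1 \<le> y" "y \<le> x" "x \<le> n"
      unfolding iff using assms by (auto split: if_splits)
  next
    fix x x' y assume "eps_succ n i x = Some y" "eps_succ n i x' = Some y"
    then show "x = x'" unfolding iff by (auto split: if_splits)
  next
    fix x x' y y' assume "eps_succ n i x = Some y" "eps_succ n i x' = Some y'" "x \<le> x'"
    then show "y \<le> y'" unfolding iff by (auto split: if_splits)
  qed
  then show "eps_succ n i \<in> carrier (IC n)" by (simp add: IC_def)
  show "dom (eps_succ n i) = {1..n} - {i}"
    by (auto simp: dom_def iff)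
qed

lemma monoid_IC: "monoid (IC n)"
proof
  fix \<alpha> \<beta> assume "\<alpha> \<in> carrier (IC n)" "\<beta> \<in> carrier (IC n)"
  then have a: "\<alpha> \<in> IC_maps n" and b: "\<beta> \<in> IC_maps n" by (simp_all add: IC_def)
  have "\<beta> \<circ>\<^sub>m \<alpha> \<in> IC_maps n"
    unfolding IC_maps_iff map_comp_Some_iff
  proof (intro conjI allI impI; elim exE conjE)
    fix x y k assume "\<alpha> x = Some k" "\<beta> k = Some y"
    with a b show "1 \<le> y" "y \<le> x" "x \<le> n"
      unfolding IC_maps_iff by (blast intro: le_trans)+
  next
    fix x x' y k k' assume "\<alpha> x = Some k" "\<beta> k = Some y" "\<alpha> x' = Some k'" "\<beta> k' = Some y"
    with a b show "x = x'" unfolding IC_maps_iff by blast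
  next
    fix x x' y y' k k'
    assume "x \<le> x'" "\<alpha> x = Some k" "\<beta> k = Some y" "\<alpha> x' = Some k'" "\<beta> k' = Some y'"
    with a b show "y \<le> y'" unfolding IC_maps_iff by blast
  qed
  then show "\<alpha> \<otimes>\<^bsub>IC n\<^esub> \<beta> \<in> carrier (IC n)" by (simp add: IC_def)
next
  show "\<one>\<^bsub>IC n\<^esub> \<in> carrier (IC n)"
    by (simp add: IC_def IC_maps_iff partial_id_eq_Some_iff)
next
  fix \<alpha> assume "\<alpha> \<in> carrier (IC n)"
  then have "\<alpha> \<in> IC_maps n" by (simp add: IC_def)
  then have D: "1 \<le> y \<and> y \<le> x \<and> x \<le> n" if "\<alpha> x = Some y" for x y
    using that unfolding IC_maps_iff by blast
  show "\<one>\<^bsub>IC n\<^esub> \<otimes>\<^bsub>IC n\<^esub> \<alpha> = \<alpha>"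
  proof
    fix x show "(\<one>\<^bsub>IC n\<^esub> \<otimes>\<^bsub>IC n\<^esub> \<alpha>) x = \<alpha> x"
      using D[of x] by (cases "\<alpha> x") (auto simp: IC_def partial_id_def restrict_map_def map_comp_def)
  qed
  show "\<alpha> \<otimes>\<^bsub>IC n\<^esub> \<one>\<^bsub>IC n\<^esub> = \<alpha>"
  proof
    fix x show "(\<alpha> \<otimes>\<^bsub>IC n\<^esub> \<one>\<^bsub>IC n\<^esub>) x = \<alpha> x"
      using D[of x] by (cases "\<alpha> x") (auto simp: IC_def partial_id_def restrict_map_def map_comp_def)
  qed
next
  fix \<alpha> \<beta> \<gamma>
  show "\<alpha> \<otimes>\<^bsub>IC n\<^esub> \<beta> \<otimes>\<^bsub>IC n\<^esub> \<gamma> = \<alpha> \<otimes>\<^bsub>IC n\<^esub> (\<beta> \<otimes>\<^bsub>IC n\<^esub> \<gamma>)"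
    by (simp add: IC_def map_comp_def fun_eq_iff split: option.split)
qed

end

theory Submission
  imports Defs
begin

text \<open>
  If a semigroup is generated by a set of elements \<open>a\<close> that are irreducible, in the sense that
  \<open>a = x y\<close> forces \<open>x = a\<close> or \<open>y = a\<close>, then its maximal subsemigroups are exactly the complements of
  single generators. In \<open>IC n\<close> the identity, the \<open>eps_succ n i\<close> and the \<open>eps n i\<close> are irreducible
  because \<open>\<alpha>\<beta>\<close> fixes \<open>x\<close> only if both \<open>\<alpha>\<close> and \<open>\<beta>\<close> do. They generate: if \<open>\<alpha>\<close> is not a partial
  identity and \<open>x\<close> is the least point that it moves, then \<open>x - 1\<close> is outside its domain, and
  \<open>eps_succ n (x - 1)\<close> splits off on the left, leaving a map with \<open>x\<close> replaced by \<open>x - 1\<close> in the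
  domain.
\<close>

section \<open>Monoids generated by irreducible elements\<close>

definition irreducible_element :: "('a, 'b) monoid_scheme \<Rightarrow> 'a \<Rightarrow> bool" where
  "irreducible_element S a \<longleftrightarrow> a \<in> carrier S \<and>
     (\<forall>x\<in>carrier S. \<forall>y\<in>carrier S. x \<otimes>\<^bsub>S\<^esub> y = a \<longrightarrow> x = a \<or> y = a)"

lemma (in monoid) subsemigroup_Diff_irreducible:
  assumes "irreducible_element G a"
  shows "subsemigroup G (carrier G - {a})"
  using assms unfolding subsemigroup_def irreducible_element_def by blast

text \<open>A proper subsemigroup misses some \<open>a\<close> in \<open>A\<close>, since
  \<open>A\<close> generates. It then lies in the complement of \<open>a\<close>, itself a proper
  subsemigroup, and maximality forces equality. Conversely, a complement of one element can only
  grow to the whole carrier; \<open>ne\<close> keeps it non-empty.\<close>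

lemma (in monoid) maximal_subsemigroup_iff_irreducible:
  assumes irr: "\<And>a. a \<in> A \<Longrightarrow> irreducible_element G a"
    and gen: "\<And>T. subsemigroup G T \<Longrightarrow> A \<subseteq> T \<Longrightarrow> T = carrier G"
    and ne: "\<And>a. carrier G \<noteq> {a}"
  shows "maximal_subsemigroup G M \<longleftrightarrow> (\<exists>a\<in>A. M = carrier G - {a})"
proof
  assume M: "maximal_subsemigroup G M"
  then have sub: "subsemigroup G M" and "M \<noteq> carrier G"
    unfolding maximal_subsemigroup_def by auto
  with gen obtain a where a: "a \<in> A" "a \<notin> M" by blast
  with sub have "M \<subseteq> carrier G - {a}"
    unfolding subsemigroup_def by blast
  moreover have "carrier G - {a} \<noteq> carrier G"
    using irr[OF a(1)] unfolding irreducible_element_def by blast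
  ultimately have "M = carrier G - {a}"
    using M subsemigroup_Diff_irreducible[OF irr[OF a(1)]]
    unfolding maximal_subsemigroup_def by blast
  with a show "\<exists>a\<in>A. M = carrier G - {a}" by blast
next
  assume "\<exists>a\<in>A. M = carrier G - {a}"
  then obtain a where a: "a \<in> A" and M: "M = carrier G - {a}" by blast
  have aG: "a \<in> carrier G"
    using irr[OF a] unfolding irreducible_element_def by blast
  show "maximal_subsemigroup G M"
    unfolding maximal_subsemigroup_def
  proof (intro conjI allI impI)
    show "subsemigroup G M"
      unfolding M by (rule subsemigroup_Diff_irreducible[OF irr[OF a]])
    show "M \<noteq> {}" "M \<noteq> carrier G" using M aG ne[of a] by auto
    fix T assume "subsemigroup G T \<and> M \<subseteq> T"
    then have "carrier G - {a} \<subseteq> T" "T \<subseteq> carrier G"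
      unfolding M subsemigroup_def by auto
    then show "T = M \<or> T = carrier G"
      unfolding M by (cases "a \<in> T") auto
  qed
qed

section \<open>Fixed points of maps in \<open>IC n\<close>\<close>

lemma carrier_IC: "carrier (IC n) = IC_maps n"
  and mult_IC: "\<alpha> \<otimes>\<^bsub>IC n\<^esub> \<beta> = \<beta> \<circ>\<^sub>m \<alpha>"
  and one_IC: "\<one>\<^bsub>IC n\<^esub> = partial_id {1..n}"
  by (simp_all add: IC_def)

lemma IC_maps_bounds:
  assumes "\<alpha> \<in> IC_maps n" "\<alpha> x = Some y"
  shows "1 \<le> y" "y \<le> x" "x \<le> n"
  using assms unfolding IC_maps_iff by blast+

lemma IC_maps_inj:
  assumes "\<alpha> \<in> IC_maps n" "\<alpha> x = Some y" "\<alpha> x' = Some y"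
  shows "x = x'"
  using assms unfolding IC_maps_iff by blast

lemma IC_maps_mono:
  assumes "\<alpha> \<in> IC_maps n" "\<alpha> x = Some y" "\<alpha> x' = Some y'" "x \<le> x'"
  shows "y \<le> y'"
  using assms unfolding IC_maps_iff by blast

lemma partial_id_apply: "partial_id A x = (if x \<in> A then Some x else None)"
  by (simp add: partial_id_def restrict_map_def)

lemma eps_apply: "eps n i x = (if x \<in> {1..n} \<and> x \<noteq> i then Some x else None)"
  by (simp add: eps_def partial_id_apply)

lemma eps_succ_apply:
  "eps_succ n i x =
     (if x = i + 1 then Some i else if x \<in> {1..n} \<and> x \<noteq> i then Some x else None)"
  by (simp add: eps_succ_def partial_id_apply)

text \<open>Both factors are order-decreasing, so the path from \<open>x\<close> through
  \<open>k\<close> back to \<open>x\<close> can never leave \<open>x\<close>.\<close>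

lemma comp_fixes_imp_fixes:
  assumes "\<alpha> \<in> IC_maps n" "\<beta> \<in> IC_maps n" "(\<beta> \<circ>\<^sub>m \<alpha>) x = Some x"
  shows "\<alpha> x = Some x" "\<beta> x = Some x"
proof -
  obtain k where k: "\<alpha> x = Some k" "\<beta> k = Some x"
    using assms(3) by (auto simp: map_comp_Some_iff)
  with IC_maps_bounds(2)[OF assms(1) k(1)] IC_maps_bounds(2)[OF assms(2) k(2)]
  show "\<alpha> x = Some x" "\<beta> x = Some x" by simp_all
qed

text \<open>An image of \<open>i\<close> below \<open>i\<close> would already be taken by a fixed
  point, against injectivity.\<close>

lemma fixes_below_imp_fixed_or_undefined:
  assumes \<alpha>: "\<alpha> \<in> IC_maps n"
    and fixed: "\<And>x. x \<in> {1..<i} \<Longrightarrow> \<alpha> x = Some x"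
  shows "\<alpha> i = None \<or> \<alpha> i = Some i"
proof (cases "\<alpha> i")
  case (Some y)
  have "y = i"
  proof (rule ccontr)
    assume "y \<noteq> i"
    with IC_maps_bounds[OF \<alpha> Some] have "y \<in> {1..<i}" by simp
    with IC_maps_inj[OF \<alpha> Some fixed] \<open>y \<noteq> i\<close> show False by blast
  qed
  with Some show ?thesis by simp
qed simp

lemma IC_maps_undefined:
  assumes "\<alpha> \<in> IC_maps n" "x \<notin> {1..n}"
  shows "\<alpha> x = None"
proof (cases "\<alpha> x")
  case (Some y)
  then show ?thesis using IC_maps_bounds[OF assms(1) Some] assms(2) by simp
qed simp

lemma fixes_all_but_one_cases:
  assumes \<alpha>: "\<alpha> \<in> IC_maps n" and fixed: "\<And>x. x \<in> {1..n} - {i} \<Longrightarrow> \<alpha> x = Some x"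
    and i: "i \<in> {1..n}"
  shows "\<alpha> = partial_id {1..n} \<or> \<alpha> = eps n i"
proof -
  have "\<alpha> i = None \<or> \<alpha> i = Some i"
    using fixes_below_imp_fixed_or_undefined[OF \<alpha>, of i] fixed i by simp
  then show ?thesis
  proof
    assume "\<alpha> i = None"
    then have "\<alpha> = eps n i"
      using fixed IC_maps_undefined[OF \<alpha>] by (fastforce simp: fun_eq_iff eps_apply)
    then show ?thesis ..
  next
    assume "\<alpha> i = Some i"
    then have "\<alpha> = partial_id {1..n}"
      using fixed IC_maps_undefined[OF \<alpha>] by (fastforce simp: fun_eq_iff partial_id_apply)
    then show ?thesis ..
  qed
qed

text \<open>Only the value at \<open>i\<close> is open. All smaller points are fixed, so
  \<open>i\<close> is fixed or undefined, and it cannot be fixed because \<open>i\<close> is already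
  the image of \<open>i + 1\<close>.\<close>

lemma eq_eps_succI:
  assumes \<alpha>: "\<alpha> \<in> IC_maps n" and fixed: "\<And>x. x \<in> {1..n} - {i, i + 1} \<Longrightarrow> \<alpha> x = Some x"
    and succ: "\<alpha> (i + 1) = Some i"
  shows "\<alpha> = eps_succ n i"
proof
  fix x
  have "i + 1 \<le> n" using IC_maps_bounds[OF \<alpha> succ] by simp
  have "\<alpha> i \<noteq> Some i"
    using IC_maps_inj[OF \<alpha> succ, of i] by auto
  then have "\<alpha> i = None"
    using fixes_below_imp_fixed_or_undefined[OF \<alpha>, of i] fixed \<open>i + 1 \<le> n\<close> by auto
  then show "\<alpha> x = eps_succ n i x"
    using fixed[of x] succ IC_maps_undefined[OF \<alpha>, of x] by (auto simp: eps_succ_apply)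
qed

section \<open>Irreducibility of the generators\<close>

lemma irreducible_one: "irreducible_element (IC n) \<one>\<^bsub>IC n\<^esub>"
  unfolding irreducible_element_def
proof (intro conjI ballI impI)
  show "\<one>\<^bsub>IC n\<^esub> \<in> carrier (IC n)" using monoid.one_closed[OF monoid_IC] .
  fix \<alpha> \<beta> assume *: "\<alpha> \<in> carrier (IC n)" "\<beta> \<in> carrier (IC n)"
    and eq: "\<alpha> \<otimes>\<^bsub>IC n\<^esub> \<beta> = \<one>\<^bsub>IC n\<^esub>"
  then have \<alpha>: "\<alpha> \<in> IC_maps n" and \<beta>: "\<beta> \<in> IC_maps n" by (simp_all add: carrier_IC)
  have "\<alpha> x = Some x" if "x \<in> {1..n}" for x
    using comp_fixes_imp_fixes(1)[OF \<alpha> \<beta>, of x] eq that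
    by (simp add: mult_IC one_IC partial_id_apply)
  then have "\<alpha> = \<one>\<^bsub>IC n\<^esub>"
    using IC_maps_undefined[OF \<alpha>] by (auto simp: fun_eq_iff partial_id_apply one_IC)
  then show "\<alpha> = \<one>\<^bsub>IC n\<^esub> \<or> \<beta> = \<one>\<^bsub>IC n\<^esub>" ..
qed

lemma irreducible_eps:
  assumes i: "i \<in> {1..n}"
  shows "irreducible_element (IC n) (eps n i)"
  unfolding irreducible_element_def
proof (intro conjI ballI impI)
  show "eps n i \<in> carrier (IC n)" by (rule eps_in_IC)
  fix \<alpha> \<beta> assume "\<alpha> \<in> carrier (IC n)" "\<beta> \<in> carrier (IC n)"
    and eq: "\<alpha> \<otimes>\<^bsub>IC n\<^esub> \<beta> = eps n i"
  then have \<alpha>: "\<alpha> \<in> IC_maps n" and \<beta>: "\<beta> \<in> IC_maps n" by (simp_all add: carrier_IC)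
  have "(\<beta> \<circ>\<^sub>m \<alpha>) x = Some x" if "x \<in> {1..n} - {i}" for x
    using eq that by (simp add: mult_IC eps_apply)
  then have fixed: "\<alpha> x = Some x \<and> \<beta> x = Some x" if "x \<in> {1..n} - {i}" for x
    using comp_fixes_imp_fixes[OF \<alpha> \<beta>, of x] that by blast
  \<comment> \<open>Each factor is the identity or \<open>eps n i\<close>; this excludes that both
    are the identity.\<close>
  have "\<not> (\<alpha> i = Some i \<and> \<beta> i = Some i)"
    using fun_cong[OF eq, of i] by (auto simp: mult_IC eps_apply)
  moreover have "\<alpha> = partial_id {1..n} \<or> \<alpha> = eps n i" "\<beta> = partial_id {1..n} \<or> \<beta> = eps n i"
    using fixes_all_but_one_cases[OF \<alpha> _ i] fixes_all_but_one_cases[OF \<beta> _ i] fixed by blast+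
  ultimately show "\<alpha> = eps n i \<or> \<beta> = eps n i"
    using i by (auto simp: partial_id_apply)
qed

text \<open>Both factors fix every point other than \<open>i\<close> and \<open>i + 1\<close>, and
  the unit step from \<open>i + 1\<close> down to \<open>i\<close> cannot be shared: one factor
  makes all of it.\<close>

lemma irreducible_eps_succ:
  assumes i: "1 \<le> i" "i \<le> n - 1"
  shows "irreducible_element (IC n) (eps_succ n i)"
  unfolding irreducible_element_def
proof (intro conjI ballI impI)
  show "eps_succ n i \<in> carrier (IC n)" using i by (rule eps_succ_in_IC)
  fix \<alpha> \<beta> assume "\<alpha> \<in> carrier (IC n)" "\<beta> \<in> carrier (IC n)"
    and eq: "\<alpha> \<otimes>\<^bsub>IC n\<^esub> \<beta> = eps_succ n i"
  then have \<alpha>: "\<alpha> \<in> IC_maps n" and \<beta>: "\<beta> \<in> IC_maps n" by (simp_all add: carrier_IC)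
  have "(\<beta> \<circ>\<^sub>m \<alpha>) x = Some x" if "x \<in> {1..n} - {i, i + 1}" for x
    using eq that by (simp add: mult_IC eps_succ_apply)
  then have fixed: "\<alpha> x = Some x \<and> \<beta> x = Some x" if "x \<in> {1..n} - {i, i + 1}" for x
    using comp_fixes_imp_fixes[OF \<alpha> \<beta>, of x] that by blast
  have "(\<beta> \<circ>\<^sub>m \<alpha>) (i + 1) = Some i"
    using eq by (simp add: mult_IC eps_succ_apply)
  then obtain k where k: "\<alpha> (i + 1) = Some k" "\<beta> k = Some i"
    by (auto simp: map_comp_Some_iff)
  \<comment> \<open>If \<open>k = i\<close>, then \<open>\<alpha>\<close> sends \<open>i + 1\<close>
    to \<open>i\<close>; if \<open>k = i + 1\<close>, then \<open>\<beta>\<close> does.\<close>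
  have "k = i \<or> k = i + 1"
    using IC_maps_bounds(2)[OF \<alpha> k(1)] IC_maps_bounds(2)[OF \<beta> k(2)] by arith
  then show "\<alpha> = eps_succ n i \<or> \<beta> = eps_succ n i"
    using eq_eps_succI[OF \<alpha>, of i] eq_eps_succI[OF \<beta>, of i] fixed k by blast
qed

section \<open>Generation of \<open>IC n\<close>\<close>

lemma partial_id_in_subsemigroup:
  assumes T: "subsemigroup (IC n) T" and one: "\<one>\<^bsub>IC n\<^esub> \<in> T"
    and eps: "\<And>i. i \<in> {1..n} \<Longrightarrow> eps n i \<in> T" and A: "A \<subseteq> {1..n}"
  shows "partial_id A \<in> T"
proof -
  \<comment> \<open>The induction is on the complement of the domain: the identity is the start, and
    each factor \<open>eps n i\<close> deletes one more point.\<close>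
  have "partial_id ({1..n} - B) \<in> T" if "finite B" "B \<subseteq> {1..n}" for B
    using that
  proof (induction B rule: finite_induct)
    case empty
    then show ?case using one by (simp add: one_IC)
  next
    case (insert i B)
    have "partial_id ({1..n} - insert i B) = partial_id ({1..n} - B) \<otimes>\<^bsub>IC n\<^esub> eps n i"
      by (auto simp: fun_eq_iff mult_IC partial_id_apply eps_apply map_comp_def)
    with insert T eps show ?case
      unfolding subsemigroup_def by auto
  qed
  from this[of "{1..n} - A"] A show ?thesis
    by (simp add: double_diff finite_subset)
qed

text \<open>Take \<open>Suc x\<close> to be the least moved point. If \<open>x\<close> were in the
  domain, it would be fixed by minimality; monotonicity and \<open>y \<le> x\<close> would then give
  \<open>Suc x\<close> the image \<open>x\<close> as well, against injectivity.\<close>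

lemma exists_moved_point:
  assumes \<alpha>: "\<alpha> \<in> IC_maps n" and not_id: "\<alpha> \<noteq> partial_id (dom \<alpha>)"
  obtains x y where "\<alpha> (Suc x) = Some y" "y \<le> x" "\<alpha> x = None"
proof -
  define P where "P x \<longleftrightarrow> (\<exists>y. \<alpha> x = Some y \<and> y < x)" for x
  have "\<exists>x. P x"
  proof (rule ccontr)
    assume none: "\<nexists>x. P x"
    have "\<alpha> x = partial_id (dom \<alpha>) x" for x
    proof (cases "\<alpha> x")
      case None
      then show ?thesis by (simp add: partial_id_apply domIff)
    next
      case (Some y)
      with none IC_maps_bounds(2)[OF \<alpha> Some] have "y = x"
        unfolding P_def by (meson le_neq_implies_less)
      with Some show ?thesis by (simp add: partial_id_apply domI)
    qed
    with not_id show False by (simp add: fun_eq_iff)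
  qed
  then have least: "P (Least P)" by (metis LeastI)
  then obtain y where y: "\<alpha> (Least P) = Some y" "y < Least P" unfolding P_def by blast
  then obtain x where x: "Least P = Suc x" by (cases "Least P") auto
  have "\<alpha> x = None"
  proof (rule ccontr)
    assume "\<alpha> x \<noteq> None"
    then obtain z where z: "\<alpha> x = Some z" by blast
    have "\<not> P x" using x not_less_Least[of x P] by simp
    with z IC_maps_bounds(2)[OF \<alpha> z] have "z = x" unfolding P_def by (meson le_neq_implies_less)
    with IC_maps_mono[OF \<alpha> z y(1)] x y(2) have "y = z" by simp
    with IC_maps_inj[OF \<alpha> z, of "Suc x"] y(1) x show False by simp
  qed
  with y x show ?thesis using that by simp
qed

text \<open>The left factor moves \<open>Suc x\<close> to the free place \<open>x\<close>, from
  which the new map continues to \<open>y\<close>. This map is order-decreasing because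
  \<open>y \<le> x\<close>, and isotone because no natural number lies strictly between
  \<open>x\<close> and \<open>Suc x\<close>.\<close>

lemma eps_succ_factorisation:
  assumes \<alpha>: "\<alpha> \<in> IC_maps n" and y: "\<alpha> (Suc x) = Some y" "y \<le> x" and x: "\<alpha> x = None"
  shows "\<alpha>(Suc x := None, x \<mapsto> y) \<in> IC_maps n"
    and "\<alpha> = eps_succ n x \<otimes>\<^bsub>IC n\<^esub> \<alpha>(Suc x := None, x \<mapsto> y)"
proof -
  let ?\<beta> = "\<alpha>(Suc x := None, x \<mapsto> y)"
  have le: "1 \<le> y" "Suc x \<le> n" using IC_maps_bounds[OF \<alpha> y(1)] by simp_all
  have \<beta>: "?\<beta> z = Some w \<longleftrightarrow> (z = x \<and> w = y) \<or> (z \<noteq> x \<and> z \<noteq> Suc x \<and> \<alpha> z = Some w)" for z w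
    by auto
  show "?\<beta> \<in> IC_maps n"
    unfolding IC_maps_iff
  proof (intro conjI allI impI)
    fix z w assume "?\<beta> z = Some w"
    then show "1 \<le> w" "w \<le> z" "z \<le> n"
      unfolding \<beta> using le y(2) IC_maps_bounds[OF \<alpha>] by auto
  next
    fix z z' w assume "?\<beta> z = Some w" "?\<beta> z' = Some w"
    then show "z = z'"
      unfolding \<beta> using IC_maps_inj[OF \<alpha> y(1)] IC_maps_inj[OF \<alpha>] by metis
  next
    fix z z' w w' assume "?\<beta> z = Some w" "?\<beta> z' = Some w'" "z \<le> z'"
    \<comment> \<open>In the two mixed cases the point \<open>x\<close> of the new map plays the
      part of \<open>Suc x\<close> in \<open>\<alpha>\<close>, so monotonicity of
      \<open>\<alpha>\<close> applies at \<open>Suc x\<close>.\<close>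
    then consider "z = x" "w = y" "z' = x" "w' = y"
      | "z = x" "w = y" "Suc x \<le> z'" "\<alpha> z' = Some w'"
      | "z \<le> Suc x" "\<alpha> z = Some w" "z' = x" "w' = y"
      | "\<alpha> z = Some w" "\<alpha> z' = Some w'"
      unfolding \<beta> by force
    then show "w \<le> w'"
      using IC_maps_mono[OF \<alpha> y(1)] IC_maps_mono[OF \<alpha> _ y(1)] IC_maps_mono[OF \<alpha> _ _ \<open>z \<le> z'\<close>]
      by cases auto
  qed
  show "\<alpha> = eps_succ n x \<otimes>\<^bsub>IC n\<^esub> ?\<beta>"
  proof
    fix z
    show "\<alpha> z = (eps_succ n x \<otimes>\<^bsub>IC n\<^esub> ?\<beta>) z"
      using x y(1) IC_maps_undefined[OF \<alpha>, of z]
      by (auto simp: mult_IC eps_succ_apply map_comp_def)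
  qed
qed

lemma IC_generated:
  assumes T: "subsemigroup (IC n) T" and one: "\<one>\<^bsub>IC n\<^esub> \<in> T"
    and eps: "\<And>i. i \<in> {1..n} \<Longrightarrow> eps n i \<in> T"
    and eps_succ: "\<And>i. 1 \<le> i \<Longrightarrow> i \<le> n - 1 \<Longrightarrow> eps_succ n i \<in> T"
  shows "T = carrier (IC n)"
proof
  show "T \<subseteq> carrier (IC n)" using T unfolding subsemigroup_def by blast
  have "\<alpha> \<in> T" if "\<alpha> \<in> IC_maps n" for \<alpha>
    using that
  \<comment> \<open>Splitting off \<open>eps_succ n x\<close> keeps the size of the domain, so the
    measure is the sum of its points, which drops by exactly one.\<close>
  proof (induction "\<Sum>(dom \<alpha>)" arbitrary: \<alpha> rule: less_induct)
    case less
    have dom: "dom \<alpha> \<subseteq> {1..n}" using less.prems unfolding IC_maps_def by blast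
    show ?case
    proof (cases "\<alpha> = partial_id (dom \<alpha>)")
      case True
      with partial_id_in_subsemigroup[OF T one eps dom] show ?thesis by simp
    next
      case False
      then obtain x y where xy: "\<alpha> (Suc x) = Some y" "y \<le> x" "\<alpha> x = None"
        using exists_moved_point[OF less.prems] by blast
      let ?\<beta> = "\<alpha>(Suc x := None, x \<mapsto> y)"
      \<comment> \<open>From \<open>1 \<le> y \<le> x\<close> and \<open>Suc x \<le> n\<close>, the
        left factor is one of the given generators.\<close>
      have x: "1 \<le> x" "x \<le> n - 1"
        using IC_maps_bounds[OF less.prems xy(1)] xy(2) by simp_all
      have fin: "finite (dom \<alpha>)" using dom finite_subset by blast
      have "\<Sum>(dom ?\<beta>) = x + \<Sum>(dom \<alpha> - {Suc x})"
        using fin xy(3) by (simp add: domIff)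
      moreover have "\<Sum>(dom \<alpha>) = Suc x + \<Sum>(dom \<alpha> - {Suc x})"
        using fin xy(1) by (intro sum.remove) auto
      ultimately have "?\<beta> \<in> T"
        using less.hyps eps_succ_factorisation(1)[OF less.prems xy] by simp
      then show ?thesis
        using T eps_succ[OF x] eps_succ_factorisation(2)[OF less.prems xy]
        unfolding subsemigroup_def by metis
    qed
  qed
  then show "carrier (IC n) \<subseteq> T" by (auto simp: carrier_IC)
qed

theorem theorem4p1:
  fixes n :: nat and M :: "(nat \<Rightarrow> nat option) set"
  assumes "n \<ge> 1"
  shows "maximal_subsemigroup (IC n) M \<longleftrightarrow>
           M = carrier (IC n) - {\<one>\<^bsub>IC n\<^esub>} \<or>
           (\<exists>i. 1 \<le> i \<and> i \<le> n - 1 \<and> M = carrier (IC n) - {eps_succ n i}) \<or>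
           (\<exists>i. 1 \<le> i \<and> i \<le> n \<and> M = carrier (IC n) - {eps n i})"
proof -
  interpret monoid "IC n" by (rule monoid_IC)
  define A where "A = {\<one>\<^bsub>IC n\<^esub>} \<union> eps_succ n ` {1..n - 1} \<union> eps n ` {1..n}"
  have "maximal_subsemigroup (IC n) M \<longleftrightarrow> (\<exists>a\<in>A. M = carrier (IC n) - {a})"
  proof (rule maximal_subsemigroup_iff_irreducible)
    show "irreducible_element (IC n) a" if "a \<in> A" for a
      using that irreducible_one irreducible_eps irreducible_eps_succ unfolding A_def by auto
    show "T = carrier (IC n)" if "subsemigroup (IC n) T" "A \<subseteq> T" for T
      using that by (intro IC_generated) (auto simp: A_def)
    \<comment> \<open>The assumption \<open>n \<ge> 1\<close> enters here: it provides two distinct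
      elements, whereas \<open>IC 0\<close> contains only the empty map.\<close>
    have "eps n 1 1 \<noteq> \<one>\<^bsub>IC n\<^esub> 1"
      using assms by (simp add: eps_apply one_IC partial_id_apply)
    then show "carrier (IC n) \<noteq> {a}" for a
      using eps_in_IC[of n 1] one_closed by (metis singletonD)
  qed
  moreover have "(\<exists>a\<in>A. P a) \<longleftrightarrow> P \<one>\<^bsub>IC n\<^esub> \<or> (\<exists>i. 1 \<le> i \<and> i \<le> n - 1 \<and> P (eps_succ n i)) \<or>
      (\<exists>i. 1 \<le> i \<and> i \<le> n \<and> P (eps n i))" for P
    unfolding A_def by (auto simp: bex_Un)
  ultimately show ?thesis by (rule trans)
qed

end
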